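(* Let $\mathbf x^\ast$ be a fixed target input, let $\mathcal A$ be the conditioning sigma-field, let $K\in\mathcal K$ be a fixed candidate retained-panel count, and let $\mathbf\Phi(\mathbf x^\ast)\in\mathbb R^{N\times L}$, $\bar{\mathbf D}_K(\mathbf x^\ast)\in\mathbb R^{N\times N}$ (diagonal with nonnegative entries) and $\boldsymbol\mu\in\mathbb R^N$ be $\mathcal A$-measurable (i.e. fixed given $\mathcal A$), with $\mathbf\Phi(\mathbf x^\ast)^\top\bar{\mathbf D}_K(\mathbf x^\ast)\mathbf\Phi(\mathbf x^\ast)$ invertible. Put $$\mathbf H_K(\mathbf x^\ast)=\mathbf\Phi(\mathbf x^\ast)\{\mathbf\Phi(\mathbf x^\ast)^\top\bar{\mathbf D}_K(\mathbf x^\ast)\mathbf\Phi(\mathbf x^\ast)\}^{-1}\mathbf\Phi(\mathbf x^\ast)^\top\bar{\mathbf D}_K(\mathbf x^\ast).$$ Let $\mathbf y^\circ=\boldsymbol\mu+\boldsymbol\epsilon^\circ$ be a random vector in $\mathbb R^N$ with $E^\circ\{\boldsymbol\epsilon^\circ\mid\mathcal A\}=\mathbf 0$ and $\mathrm{Var}^\circ\{\boldsymbol\epsilon^\circ\mid\mathcal A\}=\sigma^2\mathbf I$, where $\sigma^2\ge 0$ is a constant. Define $$\mathrm{MSPE}_0(K;\mathbf x^\ast)=E^\circ\left[\left\|\mathbf H_K(\mathbf x^\ast)\mathbf y^\circ-\boldsymbol\mu\right\|^2_{\bar{\mathbf D}_K(\mathbf x^\ast)}\,\middle|\,\mathcal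 A\right],$$ $$R_K^\circ(\mathbf x^\ast)=\left\|\mathbf y^\circ-\mathbf H_K(\mathbf x^\ast)\mathbf y^\circ\right\|^2_{\bar{\mathbf D}_K(\mathbf x^\ast)},\qquad \mathrm{GDF}_K(\mathbf x^\ast)=\operatorname{tr}\{\bar{\mathbf D}_K(\mathbf x^\ast)\mathbf H_K(\mathbf x^\ast)\}.$$ If the weights are normalized, i.e. $\operatorname{tr}\{\bar{\mathbf D}_K(\mathbf x^\ast)\}=1$, then $$\mathrm{MSPE}_0(K;\mathbf x^\ast)=E^\circ\{R_K^\circ(\mathbf x^\ast)\mid\mathcal A\}+2\sigma^2\,\mathrm{GDF}_K(\mathbf x^\ast)-\sigma^2.$$ If the normalization $\operatorname{tr}\{\bar{\mathbf D}_K(\mathbf x^\ast)\}=1$ is not imposed, then the same identity holds with the final term $-\sigma^2$ replaced by $-\sigma^2\operatorname{tr}\{\bar{\mathbf D}_K(\mathbf x^\ast)\}$.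
   Context: For a vector $\mathbf v\in\mathbb R^N$ and a diagonal matrix $\mathbf D$ with nonnegative entries, $\|\mathbf v\|_{\mathbf D}^2=\mathbf v^\top\mathbf D\mathbf v$. Setting: historical panels $\{(\mathbf x_{ti},y_{ti}):i=1,\dots,n_t\}$, $t=1,\dots,T$, are stacked into a response vector $\mathbf y\in\mathbb R^N$, $N=\sum_t n_t$. The matrix $\mathbf\Phi(\mathbf x^\ast)$ has as its rows, in the same order, the local basis vectors $\boldsymbol\phi(\mathbf x_{ti},\mathbf x^\ast)^\top\in\mathbb R^{L}$. For a candidate number $K$ of retained historical panels (from a set $\mathcal K$ of candidates), $\bar{\mathbf D}_K(\mathbf x^\ast)$ is the diagonal matrix of the nonnegative observation-level prediction weights $\hat w_{ti,K}(\mathbf x^\ast)$ (supported on the $K$ retained panels), in the same order, and $\mathbf H_K(\mathbf x^\ast)$ is the resulting weighted least-squares hat matrix. The vector $\boldsymbol\mu$ is the conditional mean of the stacked responses given the historical design, and $\mathbf y^\circ$ is an independent replicate response vector. The weights and the hat matrix are treated as fixed under the conditioning. $E^\circ$ and $\mathrm{Var}^\circ$ denote expectation and variance with respect to the replicate noise $\boldsymbol\epsilon^\circ$. *)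

theory Defs
  imports "HOL-Analysis.Analysis" "HOL-Probability.Probability"
begin

text \<open>
  The type \<open>'n\<close> indexes the stacked observations (so \<open>N = CARD('n)\<close>) and \<open>'l\<close> the local basis
  functions (\<open>L = CARD('l)\<close>). Objects that depend on the target input \<open>x\<close> and on the candidate
  panel count \<open>K\<close> take these as arguments; being only measurable with respect to the conditioning
  sigma-field \<open>A\<close>, they also depend on the sample point \<open>\<omega>\<close>.
\<close>

definition diagonal_matrix :: "real^'n^'n \<Rightarrow> bool" where
  "diagonal_matrix D \<longleftrightarrow> (\<forall>i j. i \<noteq> j \<longrightarrow> D $ i $ j = 0)"

definition wnorm_sq :: "real^'n^'n \<Rightarrow> real^'n \<Rightarrow> real" where
  "wnorm_sq D v = v \<bullet> (D *v v)"

definition hat_matrix :: "real^'l^'n \<Rightarrow> real^'n^'n \<Rightarrow> real^'n^'n" where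
  "hat_matrix \<Phi> D = \<Phi> ** matrix_inv (transpose \<Phi> ** D ** \<Phi>) ** transpose \<Phi> ** D"

definition cond_mean :: "'w measure \<Rightarrow> 'w measure \<Rightarrow> ('w \<Rightarrow> real^'n) \<Rightarrow> 'w \<Rightarrow> real^'n" where
  "cond_mean M A f \<omega> = (\<chi> i. real_cond_exp M A (\<lambda>\<omega>. f \<omega> $ i) \<omega>)"

definition cond_var :: "'w measure \<Rightarrow> 'w measure \<Rightarrow> ('w \<Rightarrow> real^'n) \<Rightarrow> 'w \<Rightarrow> real^'n^'n" where
  "cond_var M A f \<omega> =
     (\<chi> i j. real_cond_exp M A
        (\<lambda>\<omega>. (f \<omega> $ i - cond_mean M A f \<omega> $ i) * (f \<omega> $ j - cond_mean M A f \<omega> $ j)) \<omega>)"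

definition H_mat ::
  "('x \<Rightarrow> 'w \<Rightarrow> real^'l^'n) \<Rightarrow> (nat \<Rightarrow> 'x \<Rightarrow> 'w \<Rightarrow> real^'n^'n) \<Rightarrow> nat \<Rightarrow> 'x \<Rightarrow> 'w \<Rightarrow> real^'n^'n" where
  "H_mat \<Phi> D K x \<omega> = hat_matrix (\<Phi> x \<omega>) (D K x \<omega>)"

text \<open>
  The loss inside \<open>MSPE0\<close> is nonnegative but, \<open>\<Phi>\<close>, \<open>D\<close> and \<open>\<mu>\<close> being random, need not be
  integrable. For nonnegative integrands \<^const>\<open>real_cond_exp\<close> is the real-valued version of the
  generalised conditional expectation \<^const>\<open>nn_cond_exp\<close>, so no integrability is needed here.
\<close>

definition MSPE0 ::
  "'w measure \<Rightarrow> 'w measure \<Rightarrow> ('x \<Rightarrow> 'w \<Rightarrow> real^'l^'n) \<Rightarrow> (nat \<Rightarrow> 'x \<Rightarrow> 'w \<Rightarrow> real^'n^'n) \<Rightarrow>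
   ('w \<Rightarrow> real^'n) \<Rightarrow> ('w \<Rightarrow> real^'n) \<Rightarrow> nat \<Rightarrow> 'x \<Rightarrow> 'w \<Rightarrow> real" where
  "MSPE0 M A \<Phi> D \<mu> y K x =
     real_cond_exp M A (\<lambda>\<omega>. wnorm_sq (D K x \<omega>) (H_mat \<Phi> D K x \<omega> *v y \<omega> - \<mu> \<omega>))"

definition R_loss ::
  "('x \<Rightarrow> 'w \<Rightarrow> real^'l^'n) \<Rightarrow> (nat \<Rightarrow> 'x \<Rightarrow> 'w \<Rightarrow> real^'n^'n) \<Rightarrow>
   ('w \<Rightarrow> real^'n) \<Rightarrow> nat \<Rightarrow> 'x \<Rightarrow> 'w \<Rightarrow> real" where
  "R_loss \<Phi> D y K x \<omega> = wnorm_sq (D K x \<omega>) (y \<omega> - H_mat \<Phi> D K x \<omega> *v y \<omega>)"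

definition GDF ::
  "('x \<Rightarrow> 'w \<Rightarrow> real^'l^'n) \<Rightarrow> (nat \<Rightarrow> 'x \<Rightarrow> 'w \<Rightarrow> real^'n^'n) \<Rightarrow> nat \<Rightarrow> 'x \<Rightarrow> 'w \<Rightarrow> real" where
  "GDF \<Phi> D K x \<omega> = trace (D K x \<omega> ** H_mat \<Phi> D K x \<omega>)"

end

theory Submission
  imports Defs
begin

text \<open>
  Both losses have the form \<open>\<parallel>a + C \<epsilon>\<parallel>\<^sup>2\<close> in the \<open>D\<close>-weighted norm, with \<open>a\<close> and \<open>C\<close> measurable with
  respect to the conditioning sigma-field: \<open>a = -(I - H) \<mu>\<close>, \<open>C = H\<close> for the prediction loss and
  \<open>a = (I - H) \<mu>\<close>, \<open>C = I - H\<close> for the residual loss. The conditional mean of such a quadratic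
  form is \<open>\<parallel>a\<parallel>\<^sup>2 + \<sigma>\<^sup>2 tr(C\<^sup>T D C)\<close>. The bias terms agree, and the two traces differ by
  \<open>tr D - 2 tr(D H)\<close>.
\<close>

section \<open>Borel measurability of vector and matrix operations\<close>

text \<open>Coordinate projections are continuous, and conversely every basis vector has the form
  \<open>axis i u\<close>, so testing against it involves a single coordinate. The entry type is any
  Euclidean space, so that two applications cover matrices, which are vectors of rows.\<close>

lemma borel_measurable_vec_iff:
  fixes f :: "'a \<Rightarrow> 'b::euclidean_space^'n"
  shows "f \<in> borel_measurable M \<longleftrightarrow> (\<forall>i. (\<lambda>x. f x $ i) \<in> borel_measurable M)"
proof
  assume f: "f \<in> borel_measurable M"
  show "\<forall>i. (\<lambda>x. f x $ i) \<in> borel_measurable M"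
  proof
    fix i
    have "(\<lambda>v::'b^'n. v $ i) \<in> borel_measurable borel"
      by (intro borel_measurable_continuous_onI continuous_intros)
    from measurable_compose[OF f this] show "(\<lambda>x. f x $ i) \<in> borel_measurable M" .
  qed
next
  assume f: "\<forall>i. (\<lambda>x. f x $ i) \<in> borel_measurable M"
  show "f \<in> borel_measurable M"
  proof (subst borel_measurable_euclidean_space, rule ballI)
    fix b :: "'b^'n"
    assume "b \<in> Basis"
    then obtain i u where "b = axis i u"
      by (auto simp: Basis_vec_def)
    with f show "(\<lambda>x. f x \<bullet> b) \<in> borel_measurable M"
      by (auto simp: inner_axis intro!: borel_measurable_inner)
  qed
qed

lemma borel_measurable_matrix_iff:
  fixes A :: "'a \<Rightarrow> real^'n^'m"
  shows "A \<in> borel_measurable M \<longleftrightarrow> (\<forall>i j. (\<lambda>x. A x $ i $ j) \<in> borel_measurable M)"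
  unfolding borel_measurable_vec_iff ..

lemma borel_measurable_det:
  fixes A :: "'a \<Rightarrow> real^'n^'n"
  assumes "\<And>i j. (\<lambda>x. A x $ i $ j) \<in> borel_measurable M"
  shows "(\<lambda>x. det (A x)) \<in> borel_measurable M"
  unfolding det_def using assms by measurable

lemma borel_measurable_matrix_mult:
  fixes A :: "'a \<Rightarrow> real^'n^'m" and B :: "'a \<Rightarrow> real^'p^'n"
  assumes "A \<in> borel_measurable M" "B \<in> borel_measurable M"
  shows "(\<lambda>x. A x ** B x) \<in> borel_measurable M"
  using assms unfolding borel_measurable_matrix_iff matrix_matrix_mult_def
  by (auto intro!: borel_measurable_sum borel_measurable_times)

lemma borel_measurable_matrix_vector_mult:
  fixes A :: "'a \<Rightarrow> real^'n^'m" and v :: "'a \<Rightarrow> real^'n"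
  assumes "A \<in> borel_measurable M" "v \<in> borel_measurable M"
  shows "(\<lambda>x. A x *v v x) \<in> borel_measurable M"
  using assms unfolding borel_measurable_matrix_iff borel_measurable_vec_iff[where f=v]
    borel_measurable_vec_iff[where f="\<lambda>x. A x *v v x"]
  by (auto simp: matrix_vector_mult_def intro!: borel_measurable_sum borel_measurable_times)

lemma borel_measurable_transpose:
  fixes A :: "'a \<Rightarrow> real^'n^'m"
  assumes "A \<in> borel_measurable M"
  shows "(\<lambda>x. transpose (A x)) \<in> borel_measurable M"
  using assms unfolding borel_measurable_matrix_iff transpose_def by auto

text \<open>Column \<open>l\<close> of the inverse solves the linear system with right-hand side
  \<open>axis l 1\<close>, so Cramer's rule applies. The entries become quotients of determinants,
  whose measurability is already known.\<close>

lemma matrix_inv_cramer: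
  fixes A :: "real^'n^'n"
  assumes "det A \<noteq> 0"
  shows "matrix_inv A $ k $ l =
    det (\<chi> i j. if j = k then axis l 1 $ i else A $ i $ j) / det A"
proof -
  have "\<exists>B. A ** B = mat 1 \<and> B ** A = mat 1"
    using assms by (simp add: invertible_det_nz flip: invertible_def)
  then have "A ** matrix_inv A = mat 1"
    unfolding matrix_inv_def by (rule someI2_ex) blast
  then have "A *v (matrix_inv A *v axis l 1) = axis l 1"
    by (simp add: matrix_vector_mul_assoc)
  then have "matrix_inv A *v axis l 1 =
      (\<chi> k. det (\<chi> i j. if j = k then axis l 1 $ i else A $ i $ j) / det A)"
    unfolding cramer[OF assms] .
  then show ?thesis
    by (simp add: matrix_vector_mult_basis column_def vec_eq_iff)
qed

text \<open>\<^const>\<open>matrix_inv\<close> takes the same junk value at all singular matrices.\<close>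

lemma borel_measurable_matrix_inv:
  fixes A :: "'a \<Rightarrow> real^'n^'n"
  assumes "A \<in> borel_measurable M"
  shows "(\<lambda>x. matrix_inv (A x)) \<in> borel_measurable M"
proof -
  have entries: "\<And>i j. (\<lambda>x. A x $ i $ j) \<in> borel_measurable M"
    using assms by (simp add: borel_measurable_matrix_iff)
  have junk: "matrix_inv B = (SOME B'. False)" if "det B = 0" for B :: "real^'n^'n"
    using that unfolding matrix_inv_def
    by (metis invertible_def invertible_det_nz)
  \<comment> \<open>The determinant is measurable, so the constant on its zero set and the quotient
    elsewhere glue to a measurable function.\<close>
  have "matrix_inv (A x) $ k $ l =
    (if det (A x) = 0 then (SOME B'::real^'n^'n. False) $ k $ l
     else det (\<chi> i j. if j = k then axis l 1 $ i else A x $ i $ j) / det (A x))" for x k l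
    by (simp add: junk matrix_inv_cramer)
  moreover have "(\<lambda>x. det (A x)) \<in> borel_measurable M"
    using entries by (rule borel_measurable_det)
  moreover have "(\<lambda>x. det (\<chi> i j. if j = k then axis l 1 $ i else A x $ i $ j)) \<in> borel_measurable M"
    for k l :: 'n
    by (rule borel_measurable_det) (simp add: entries measurable_If)
  ultimately show ?thesis
    unfolding borel_measurable_matrix_iff by auto
qed

lemma borel_measurable_hat_matrix:
  fixes \<Phi> :: "'a \<Rightarrow> real^'l^'n"
  assumes "\<Phi> \<in> borel_measurable M" "D \<in> borel_measurable M"
  shows "(\<lambda>x. hat_matrix (\<Phi> x) (D x)) \<in> borel_measurable M"
  unfolding hat_matrix_def
  by (intro borel_measurable_matrix_mult borel_measurable_matrix_inv borel_measurable_transpose assms)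

lemma borel_measurable_wnorm_sq:
  assumes "D \<in> borel_measurable M" "v \<in> borel_measurable M"
  shows "(\<lambda>x. wnorm_sq (D x) (v x)) \<in> borel_measurable M"
  unfolding wnorm_sq_def
  by (intro borel_measurable_inner borel_measurable_matrix_vector_mult assms)

section \<open>Pulling measurable coefficients out of a conditional expectation\<close>

context sigma_finite_subalgebra
begin

text \<open>\<open>real_cond_exp\<close> is built from \<open>nn_cond_exp\<close> of the positive
  and the negative part, and for nonnegative functions a measurable factor pulls out without any
  integrability. Thus \<open>f\<close> may be an arbitrary measurable function.\<close>

lemma real_cond_exp_indicator_mult:
  assumes [measurable]: "B \<in> sets F" "f \<in> borel_measurable M"
  shows "AE x in M. real_cond_exp M F (\<lambda>x. indicator B x * f x) x
    = indicator B x * real_cond_exp M F f x"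
proof -
  have "AE x in M. indicator B x * nn_cond_exp M F g x
      = nn_cond_exp M F (\<lambda>x. indicator B x * g x) x"
    if "g \<in> borel_measurable M" for g
    using that by (intro nn_cond_exp_prod) auto
  from this[of "\<lambda>x. ennreal (f x)"] this[of "\<lambda>x. ennreal (- f x)"]
  have ae: "AE x in M. indicator B x * nn_cond_exp M F (\<lambda>x. ennreal (f x)) x
      = nn_cond_exp M F (\<lambda>x. indicator B x * ennreal (f x)) x"
    "AE x in M. indicator B x * nn_cond_exp M F (\<lambda>x. ennreal (- f x)) x
      = nn_cond_exp M F (\<lambda>x. indicator B x * ennreal (- f x)) x"
    by measurable
  \<comment> \<open>A factor with values 0 and 1 commutes with taking positive and negative
    parts.\<close>
  have eq: "(\<lambda>x. ennreal (indicator B x * f x)) = (\<lambda>x. indicator B x * ennreal (f x))"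
    "(\<lambda>x. ennreal (- (indicator B x * f x))) = (\<lambda>x. indicator B x * ennreal (- f x))"
    by (auto simp: indicator_def)
  show ?thesis
    unfolding real_cond_exp_def eq using ae
    by eventually_elim (auto simp: indicator_def split: if_splits)
qed

text \<open>
  Localising to the sets where all weights are bounded by \<open>m\<close> avoids any integrability
  assumption on the products.
\<close>

lemma real_cond_exp_sum_mult:
  fixes g h :: "'i::finite \<Rightarrow> 'a \<Rightarrow> real"
  assumes g[measurable]: "\<And>i. g i \<in> borel_measurable F" and h: "\<And>i. integrable M (h i)"
  shows "AE x in M. real_cond_exp M F (\<lambda>x. \<Sum>i\<in>UNIV. g i x * h i x) x
    = (\<Sum>i\<in>UNIV. g i x * real_cond_exp M F (h i) x)"
proof -
  have [measurable]: "\<And>i. h i \<in> borel_measurable M"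
    using h by auto
  have [measurable]: "\<And>i. g i \<in> borel_measurable M"
    using g measurable_from_subalg[OF subalg] by blast
  let ?f = "\<lambda>x. \<Sum>i\<in>UNIV. g i x * h i x"
  define B where "B m = {x \<in> space F. \<forall>i. \<bar>g i x\<bar> \<le> real m}" for m :: nat
  have [measurable]: "B m \<in> sets F" for m
    unfolding B_def by measurable
  have sp: "space F = space M"
    using subalg by (simp add: subalgebra_def)
  \<comment> \<open>Within \<open>B m\<close> each product is dominated by a multiple of
    \<open>h i\<close>, so the usual pull-out and additivity rules apply. On the left the indicator
    is taken out by \<open>real_cond_exp_indicator_mult\<close>, as \<open>?f\<close> itself may
    fail to be integrable.\<close>
  have ae: "AE x in M. indicator (B m) x * real_cond_exp M F ?f x
      = indicator (B m) x * (\<Sum>i\<in>UNIV. g i x * real_cond_exp M F (h i) x)" for m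
  proof -
    have [measurable]: "B m \<in> sets M"
      using subalg by (auto simp: subalgebra_def)
    have int: "integrable M (\<lambda>x. (indicator (B m) x * g i x) * h i x)" for i
    proof (rule Bochner_Integration.integrable_bound)
      show "integrable M (\<lambda>x. real m * h i x)"
        using h by auto
      show "AE x in M. norm ((indicator (B m) x * g i x) * h i x) \<le> norm (real m * h i x)"
        by (auto simp: B_def indicator_def abs_mult intro!: mult_right_mono)
    qed measurable
    have "AE x in M. real_cond_exp M F (\<lambda>x. (indicator (B m) x * g i x) * h i x) x
        = (indicator (B m) x * g i x) * real_cond_exp M F (h i) x" for i
      using int by (intro real_cond_exp_mult) measurable
    then have "AE x in M. \<forall>i\<in>UNIV. real_cond_exp M F (\<lambda>x. (indicator (B m) x * g i x) * h i x) x
        = (indicator (B m) x * g i x) * real_cond_exp M F (h i) x"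
      by (intro AE_finite_allI) auto
    moreover have "AE x in M.
        real_cond_exp M F (\<lambda>x. \<Sum>i\<in>UNIV. (indicator (B m) x * g i x) * h i x) x
        = (\<Sum>i\<in>UNIV. real_cond_exp M F (\<lambda>x. (indicator (B m) x * g i x) * h i x) x)"
      using int by (rule real_cond_exp_sum)
    moreover have "AE x in M. real_cond_exp M F (\<lambda>x. indicator (B m) x * ?f x) x
        = indicator (B m) x * real_cond_exp M F ?f x"
      by (intro real_cond_exp_indicator_mult) measurable
    ultimately show ?thesis
      by eventually_elim (simp add: sum_distrib_left mult.assoc)
  qed
  have cover: "\<exists>m. x \<in> B m" if "x \<in> space M" for x
  proof -
    \<comment> \<open>Finitely many coefficients are bounded at once by the sum of their absolute
      values.\<close>
    obtain m where "(\<Sum>i\<in>UNIV. \<bar>g i x\<bar>) \<le> real m"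
      using real_arch_simple by blast
    moreover have "\<bar>g i x\<bar> \<le> (\<Sum>i\<in>UNIV. \<bar>g i x\<bar>)" for i
      by (rule member_le_sum) auto
    ultimately have "x \<in> B m"
      using that order_trans unfolding B_def sp by blast
    then show ?thesis ..
  qed
  \<comment> \<open>The countably many exceptional sets have a null union, so at almost every point
    an \<open>m\<close> with \<open>x\<close> in \<open>B m\<close> can be chosen, where the
    indicators equal 1.\<close>
  from ae have "AE x in M. \<forall>m. indicator (B m) x * real_cond_exp M F ?f x
      = indicator (B m) x * (\<Sum>i\<in>UNIV. g i x * real_cond_exp M F (h i) x)"
    unfolding AE_all_countable by blast
  with AE_space show ?thesis
  proof eventually_elim
    case (elim x)
    from cover[OF elim(1)] obtain m where "x \<in> B m" ..
    with elim(2)[rule_format, of m] show ?case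
      by simp
  qed
qed

end

section \<open>Conditional mean of a quadratic form in the noise\<close>

lemma sum_UNIV_option:
  fixes f :: "'n::finite option \<Rightarrow> 'a::comm_monoid_add"
  shows "(\<Sum>p\<in>UNIV. f p) = f None + (\<Sum>i\<in>UNIV. f (Some i))"
  by (simp add: UNIV_option_conv sum.reindex)

text \<open>Domination by \<open>a\<^sup>2 + b\<^sup>2\<close>. This makes the mixed products of
  noise coordinates integrable.\<close>

lemma integrable_mult_of_square_integrable:
  fixes f g :: "'a \<Rightarrow> real"
  assumes [measurable]: "f \<in> borel_measurable M" "g \<in> borel_measurable M"
    and "integrable M (\<lambda>x. (f x)\<^sup>2)" "integrable M (\<lambda>x. (g x)\<^sup>2)"
  shows "integrable M (\<lambda>x. f x * g x)"
proof (rule Bochner_Integration.integrable_bound)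
  show "integrable M (\<lambda>x. (f x)\<^sup>2 + (g x)\<^sup>2)"
    using assms by auto
  have "\<bar>a * b\<bar> \<le> a\<^sup>2 + b\<^sup>2" for a b :: real
  proof -
    have "2 * \<bar>a\<bar> * \<bar>b\<bar> \<le> a\<^sup>2 + b\<^sup>2"
      using sum_squares_bound[of "\<bar>a\<bar>" "\<bar>b\<bar>"] by simp
    moreover have "0 \<le> \<bar>a\<bar> * \<bar>b\<bar>"
      by simp
    ultimately show ?thesis
      by (simp only: abs_mult)
  qed
  then show "AE x in M. norm (f x * g x) \<le> norm ((f x)\<^sup>2 + (g x)\<^sup>2)"
    by simp
qed measurable

text \<open>Expanding the form gives coefficients measurable in \<open>F\<close> times noise moments
  of order at most two; the first moments vanish and the second ones are \<open>s\<close> on the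
  diagonal. The sum over columns of \<open>C\<close> is the trace of
  \<open>transpose C ** D ** C\<close>.\<close>

lemma (in finite_measure_subalgebra) real_cond_exp_wnorm_sq:
  fixes D :: "'a \<Rightarrow> real^'n^'n" and C :: "'a \<Rightarrow> real^'m^'n" and a :: "'a \<Rightarrow> real^'n"
    and \<epsilon> :: "'a \<Rightarrow> real^'m"
  assumes D: "D \<in> borel_measurable F" and C: "C \<in> borel_measurable F"
    and a: "a \<in> borel_measurable F" and \<epsilon>: "\<epsilon> \<in> borel_measurable M"
    and sq: "\<And>i. integrable M (\<lambda>\<omega>. (\<epsilon> \<omega> $ i)\<^sup>2)"
    and mean: "AE \<omega> in M. cond_mean M F \<epsilon> \<omega> = 0"
    and var: "AE \<omega> in M. cond_var M F \<epsilon> \<omega> = s *\<^sub>R mat 1"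
  shows "AE \<omega> in M. real_cond_exp M F (\<lambda>\<omega>. wnorm_sq (D \<omega>) (a \<omega> + C \<omega> *v \<epsilon> \<omega>)) \<omega>
    = wnorm_sq (D \<omega>) (a \<omega>) + s * (\<Sum>k\<in>UNIV. wnorm_sq (D \<omega>) (column k (C \<omega>)))"
proof -
  have [measurable]: "(\<lambda>\<omega>. \<epsilon> \<omega> $ i) \<in> borel_measurable M" for i
    using \<epsilon> by (simp add: borel_measurable_vec_iff)
  \<comment> \<open>Finiteness of the measure is what lets square integrability imply
    integrability.\<close>
  have int1: "integrable M (\<lambda>\<omega>. \<epsilon> \<omega> $ i)" for i
    by (rule square_integrable_imp_integrable) (auto simp: sq)
  have int2: "integrable M (\<lambda>\<omega>. \<epsilon> \<omega> $ i * \<epsilon> \<omega> $ j)" for i j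
    by (rule integrable_mult_of_square_integrable) (auto simp: sq)
  have E1: "AE \<omega> in M. \<forall>i. real_cond_exp M F (\<lambda>\<omega>. \<epsilon> \<omega> $ i) \<omega> = 0"
    using mean by eventually_elim (simp add: cond_mean_def vec_eq_iff)
  have E2: "AE \<omega> in M. \<forall>i j. real_cond_exp M F (\<lambda>\<omega>. \<epsilon> \<omega> $ i * \<epsilon> \<omega> $ j) \<omega>
      = (if i = j then s else 0)"
  proof -
    have [measurable]: "(\<lambda>\<omega>. cond_mean M F \<epsilon> \<omega> $ i) \<in> borel_measurable M" for i
      by (simp add: cond_mean_def)
    have "AE \<omega> in M. real_cond_exp M F (\<lambda>\<omega>. \<epsilon> \<omega> $ i * \<epsilon> \<omega> $ j) \<omega>
        = (if i = j then s else 0)" for i j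
    proof -
      \<comment> \<open>The conditional mean vanishes almost everywhere, so centring changes nothing
        there and the conditional variance yields the raw second moments.\<close>
      have "AE \<omega> in M. real_cond_exp M F (\<lambda>\<omega>. \<epsilon> \<omega> $ i * \<epsilon> \<omega> $ j) \<omega> = real_cond_exp M F
          (\<lambda>\<omega>. (\<epsilon> \<omega> $ i - cond_mean M F \<epsilon> \<omega> $ i) * (\<epsilon> \<omega> $ j - cond_mean M F \<epsilon> \<omega> $ j)) \<omega>"
        by (rule real_cond_exp_cong, use mean in eventually_elim) simp_all
      with var show ?thesis
        by eventually_elim (simp add: cond_var_def vec_eq_iff mat_def)
    qed
    then show ?thesis
      by (simp add: AE_all_countable)
  qed
  text \<open>Homogenise: the index \<open>None\<close> carries the constant term.\<close>
  define e where "e p \<omega> = (case p of None \<Rightarrow> 1 | Some i \<Rightarrow> \<epsilon> \<omega> $ i)" for p \<omega>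
  define c where "c p \<omega> = (case p of None \<Rightarrow> a \<omega> | Some i \<Rightarrow> column i (C \<omega>))" for p \<omega>
  have c_meas: "c p \<in> borel_measurable F" for p
  proof (cases p)
    case None
    then show ?thesis using a by (simp add: c_def[abs_def])
  next
    case (Some i)
    then show ?thesis
      using C by (simp add: c_def[abs_def] column_def borel_measurable_matrix_iff borel_measurable_vec_iff)
  qed
  have lin: "a \<omega> + C \<omega> *v \<epsilon> \<omega> = (\<Sum>p\<in>UNIV. e p \<omega> *\<^sub>R c p \<omega>)" for \<omega>
    by (simp add: sum_UNIV_option e_def c_def matrix_mult_sum scalar_mult_eq_scaleR)
  have quad: "wnorm_sq (D \<omega>) (a \<omega> + C \<omega> *v \<epsilon> \<omega>)
      = (\<Sum>(p, q)\<in>UNIV. (c p \<omega> \<bullet> (D \<omega> *v c q \<omega>)) * (e p \<omega> * e q \<omega>))" for \<omega>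
    unfolding lin wnorm_sq_def UNIV_Times_UNIV[symmetric] sum.cartesian_product[symmetric]
    by (simp add: linear_sum[OF matrix_vector_mul_linear] matrix_vector_mult_scaleR inner_sum_left
        inner_sum_right sum_distrib_left mult_ac, subst sum.swap, simp add: mult_ac)
  \<comment> \<open>The double sum is indexed by pairs to fit \<open>real_cond_exp_sum_mult\<close>,
    which asks integrability of the noise products only.\<close>
  have "AE \<omega> in M. real_cond_exp M F (\<lambda>\<omega>. \<Sum>z\<in>UNIV. (c (fst z) \<omega> \<bullet> (D \<omega> *v c (snd z) \<omega>))
        * (e (fst z) \<omega> * e (snd z) \<omega>)) \<omega>
      = (\<Sum>z\<in>UNIV. (c (fst z) \<omega> \<bullet> (D \<omega> *v c (snd z) \<omega>))
        * real_cond_exp M F (\<lambda>\<omega>. e (fst z) \<omega> * e (snd z) \<omega>) \<omega>)"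
  proof (rule real_cond_exp_sum_mult)
    fix z :: "'m option \<times> 'm option"
    show "(\<lambda>\<omega>. c (fst z) \<omega> \<bullet> (D \<omega> *v c (snd z) \<omega>)) \<in> borel_measurable F"
      by (intro borel_measurable_inner borel_measurable_matrix_vector_mult D c_meas)
    show "integrable M (\<lambda>\<omega>. e (fst z) \<omega> * e (snd z) \<omega>)"
      by (cases "fst z"; cases "snd z") (simp_all add: e_def int1 int2)
  qed
  \<comment> \<open>This is the moment of the pair \<open>(None, None)\<close>, the coefficient of
    the constant term.\<close>
  moreover have "AE \<omega> in M. real_cond_exp M F (\<lambda>\<omega>. 1) \<omega> = 1"
    by (rule real_cond_exp_F_meas) auto
  ultimately show ?thesis
    using E1 E2
  proof eventually_elim
    case (elim \<omega>)
    have eq: "(\<lambda>\<omega>. wnorm_sq (D \<omega>) (a \<omega> + C \<omega> *v \<epsilon> \<omega>)) =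
        (\<lambda>\<omega>. \<Sum>z\<in>UNIV. (c (fst z) \<omega> \<bullet> (D \<omega> *v c (snd z) \<omega>)) * (e (fst z) \<omega> * e (snd z) \<omega>))"
      by (simp add: quad case_prod_beta)
    \<comment> \<open>The homogenised vector has a diagonal second-moment matrix: zero mean removes
      the pairs mixing \<open>None\<close> and \<open>Some\<close>, uncorrelated noise the other
      off-diagonal ones.\<close>
    have moment: "real_cond_exp M F (\<lambda>\<omega>. e p \<omega> * e q \<omega>) \<omega>
        = (if p = q then case p of None \<Rightarrow> 1 | Some _ \<Rightarrow> s else 0)" for p q
      using elim(2-4) by (cases p; cases q) (simp_all add: e_def)
    have "(\<Sum>z\<in>UNIV. (c (fst z) \<omega> \<bullet> (D \<omega> *v c (snd z) \<omega>))
          * real_cond_exp M F (\<lambda>\<omega>. e (fst z) \<omega> * e (snd z) \<omega>) \<omega>)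
        = (\<Sum>p\<in>UNIV. \<Sum>q\<in>UNIV. (c p \<omega> \<bullet> (D \<omega> *v c q \<omega>))
          * real_cond_exp M F (\<lambda>\<omega>. e p \<omega> * e q \<omega>) \<omega>)"
      unfolding UNIV_Times_UNIV[symmetric] sum.cartesian_product by (simp add: case_prod_beta)
    also have "\<dots> = (\<Sum>p\<in>UNIV. \<Sum>q\<in>UNIV.
        if p = q then wnorm_sq (D \<omega>) (c p \<omega>) * (case p of None \<Rightarrow> 1 | Some _ \<Rightarrow> s) else 0)"
      unfolding moment by (intro sum.cong refl) (simp add: wnorm_sq_def)
    also have "\<dots> = wnorm_sq (D \<omega>) (a \<omega>)
        + s * (\<Sum>k\<in>UNIV. wnorm_sq (D \<omega>) (column k (C \<omega>)))"
      by (simp add: sum_UNIV_option c_def sum_distrib_left mult.commute)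
    finally show ?case
      using elim(1) by (simp only: eq)
  qed
qed

section \<open>Weighted norms and traces for diagonal weights\<close>

lemma wnorm_sq_diagonal:
  assumes "diagonal_matrix D"
  shows "wnorm_sq D v = (\<Sum>i\<in>UNIV. D $ i $ i * (v $ i)\<^sup>2)"
proof -
  have "(D *v v) $ i = (\<Sum>j\<in>UNIV. if j = i then D $ i $ i * v $ i else 0)" for i
    unfolding matrix_vector_mult_def vec_lambda_beta
    using assms by (intro sum.cong) (auto simp: diagonal_matrix_def)
  then show ?thesis
    by (simp add: wnorm_sq_def inner_vec_def power2_eq_square mult_ac)
qed

lemma trace_diagonal_mult:
  fixes D H :: "real^'n^'n"
  assumes "diagonal_matrix D"
  shows "trace (D ** H) = (\<Sum>i\<in>UNIV. D $ i $ i * H $ i $ i)"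
proof -
  have "(D ** H) $ i $ i = (\<Sum>j\<in>UNIV. if j = i then D $ i $ i * H $ i $ i else 0)" for i
    unfolding matrix_matrix_mult_def vec_lambda_beta
    using assms by (intro sum.cong) (auto simp: diagonal_matrix_def)
  then show ?thesis
    by (simp add: trace_def)
qed

text \<open>Expand the square of each entry of \<open>mat 1 - H\<close>: the identity contributes
  only on the diagonal, where the weighted constant and cross terms sum to \<open>trace D\<close>
  and \<open>- 2 * trace (D ** H)\<close>.\<close>

lemma sum_wnorm_sq_columns_residual:
  fixes D H :: "real^'n^'n"
  assumes "diagonal_matrix D"
  shows "(\<Sum>k\<in>UNIV. wnorm_sq D (column k (mat 1 - H)))
    = trace D - 2 * trace (D ** H) + (\<Sum>k\<in>UNIV. wnorm_sq D (column k H))"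
proof -
  have "D $ i $ i * ((mat 1 - H) $ i $ k)\<^sup>2 =
      (if i = k then D $ i $ i - 2 * (D $ i $ i * H $ i $ i) else 0) + D $ i $ i * (H $ i $ k)\<^sup>2" for i k
    by (cases "i = k") (simp_all add: mat_def power2_diff algebra_simps)
  then show ?thesis
    by (simp add: wnorm_sq_diagonal[OF assms] trace_diagonal_mult[OF assms] column_def trace_def[of D]
        sum.distrib sum_subtractf sum_distrib_left)
qed

lemma wnorm_sq_minus: "wnorm_sq D (- v) = wnorm_sq D v"
  by (simp add: wnorm_sq_def vec.neg)

section \<open>Comparison of the prediction and residual losses\<close>

theorem theorem4p1:
  fixes M A :: "'w measure"
    and \<Phi> :: "'x \<Rightarrow> 'w \<Rightarrow> real^'l^'n"
    and D :: "nat \<Rightarrow> 'x \<Rightarrow> 'w \<Rightarrow> real^'n^'n"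
    and \<mu> y \<epsilon> :: "'w \<Rightarrow> real^'n"
    and \<K> :: "nat set" and K :: nat and x :: 'x and \<sigma>2 :: real
  assumes "prob_space M" and "subalgebra M A"
    and "K \<in> \<K>"
    and "\<Phi> x \<in> borel_measurable A"
    and "D K x \<in> borel_measurable A"
    and "\<mu> \<in> borel_measurable A"
    and "AE \<omega> in M. diagonal_matrix (D K x \<omega>) \<and> (\<forall>i. D K x \<omega> $ i $ i \<ge> 0)"
    and "AE \<omega> in M. invertible (transpose (\<Phi> x \<omega>) ** D K x \<omega> ** \<Phi> x \<omega>)"
    and "\<epsilon> \<in> borel_measurable M"
    and "\<And>i. integrable M (\<lambda>\<omega>. (\<epsilon> \<omega> $ i)\<^sup>2)"
    and "\<And>\<omega>. \<omega> \<in> space M \<Longrightarrow> y \<omega> = \<mu> \<omega> + \<epsilon> \<omega>"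
    and "AE \<omega> in M. cond_mean M A \<epsilon> \<omega> = 0"
    and "\<sigma>2 \<ge> 0"
    and "AE \<omega> in M. cond_var M A \<epsilon> \<omega> = \<sigma>2 *\<^sub>R mat 1"
  shows "((AE \<omega> in M. trace (D K x \<omega>) = 1) \<longrightarrow>
           (AE \<omega> in M. MSPE0 M A \<Phi> D \<mu> y K x \<omega> =
              real_cond_exp M A (R_loss \<Phi> D y K x) \<omega> + 2 * \<sigma>2 * GDF \<Phi> D K x \<omega> - \<sigma>2))
       \<and> (AE \<omega> in M. MSPE0 M A \<Phi> D \<mu> y K x \<omega> =
              real_cond_exp M A (R_loss \<Phi> D y K x) \<omega> + 2 * \<sigma>2 * GDF \<Phi> D K x \<omega>
                - \<sigma>2 * trace (D K x \<omega>))"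
proof -
  interpret prob_space M by (rule assms(1))
  interpret finite_measure_subalgebra M A
    by unfold_locales (rule assms(2))
  let ?D = "D K x" and ?H = "H_mat \<Phi> D K x"
  have H: "?H \<in> borel_measurable A"
    unfolding H_mat_def[abs_def] by (rule borel_measurable_hat_matrix[OF assms(4,5)])
  have R: "(\<lambda>\<omega>. mat 1 - ?H \<omega>) \<in> borel_measurable A"
    using H by measurable
  have a: "(\<lambda>\<omega>. (mat 1 - ?H \<omega>) *v \<mu> \<omega>) \<in> borel_measurable A"
    using R assms(6) by (rule borel_measurable_matrix_vector_mult)
  have toM: "f \<in> borel_measurable M" if "f \<in> borel_measurable A" for f :: "'w \<Rightarrow> 'b::topological_space"
    using that by (rule measurable_from_subalg[OF subalg])
  have mu_eps: "(\<lambda>\<omega>. \<mu> \<omega> + \<epsilon> \<omega>) \<in> borel_measurable M"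
    using toM[OF assms(6)] assms(9) by measurable
  have y: "y \<in> borel_measurable M"
    using mu_eps by (subst measurable_cong[OF assms(11)])
  have Hy: "(\<lambda>\<omega>. ?H \<omega> *v y \<omega>) \<in> borel_measurable M"
    using toM[OF H] y by (rule borel_measurable_matrix_vector_mult)
  have He: "(\<lambda>\<omega>. C \<omega> *v \<epsilon> \<omega>) \<in> borel_measurable M" if "C \<in> borel_measurable A" for C :: "'w \<Rightarrow> real^'n^'n"
    using toM[OF that] assms(9) by (rule borel_measurable_matrix_vector_mult)
  \<comment> \<open>The decomposition of \<open>y\<close> is known at the points of
    \<open>space M\<close> only, so the rewriting of each loss passes through a congruence of
    conditional expectations, which requires both integrands to be measurable.\<close>
  have loss1: "AE \<omega> in M. MSPE0 M A \<Phi> D \<mu> y K x \<omega> =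
      real_cond_exp M A (\<lambda>\<omega>. wnorm_sq (?D \<omega>) (- ((mat 1 - ?H \<omega>) *v \<mu> \<omega>) + ?H \<omega> *v \<epsilon> \<omega>)) \<omega>"
    unfolding MSPE0_def
  proof (rule real_cond_exp_cong)
    show "AE \<omega> in M. wnorm_sq (?D \<omega>) (?H \<omega> *v y \<omega> - \<mu> \<omega>)
        = wnorm_sq (?D \<omega>) (- ((mat 1 - ?H \<omega>) *v \<mu> \<omega>) + ?H \<omega> *v \<epsilon> \<omega>)"
      by (rule AE_I2) (simp add: assms(11) matrix_vector_right_distrib
          matrix_vector_mult_diff_rdistrib algebra_simps)
  qed (intro borel_measurable_wnorm_sq borel_measurable_diff borel_measurable_add
      borel_measurable_uminus toM[OF assms(5)] toM[OF a] toM[OF assms(6)] Hy He H)+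
  have loss2: "AE \<omega> in M. real_cond_exp M A (R_loss \<Phi> D y K x) \<omega> =
      real_cond_exp M A (\<lambda>\<omega>. wnorm_sq (?D \<omega>)
        ((mat 1 - ?H \<omega>) *v \<mu> \<omega> + (mat 1 - ?H \<omega>) *v \<epsilon> \<omega>)) \<omega>"
    unfolding R_loss_def[abs_def]
  proof (rule real_cond_exp_cong)
    show "AE \<omega> in M. wnorm_sq (?D \<omega>) (y \<omega> - ?H \<omega> *v y \<omega>)
        = wnorm_sq (?D \<omega>) ((mat 1 - ?H \<omega>) *v \<mu> \<omega> + (mat 1 - ?H \<omega>) *v \<epsilon> \<omega>)"
      by (rule AE_I2) (simp add: assms(11) matrix_vector_right_distrib
          matrix_vector_mult_diff_rdistrib algebra_simps)
  qed (intro borel_measurable_wnorm_sq borel_measurable_diff borel_measurable_add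
      toM[OF assms(5)] toM[OF a] y Hy He R)+
  \<comment> \<open>The quadratic-form lemma is used with \<open>C\<close> equal to
    \<open>?H\<close> and to \<open>mat 1 - ?H\<close>. The bias norms, which differ only by the
    sign of the vector, and the column sums of \<open>?H\<close> cancel in the difference.\<close>
  have main: "AE \<omega> in M. MSPE0 M A \<Phi> D \<mu> y K x \<omega> =
      real_cond_exp M A (R_loss \<Phi> D y K x) \<omega> + 2 * \<sigma>2 * GDF \<Phi> D K x \<omega>
        - \<sigma>2 * trace (?D \<omega>)"
    using loss1 loss2 assms(7)
      real_cond_exp_wnorm_sq[OF assms(5) H borel_measurable_uminus[OF a] assms(9,10,12,14)]
      real_cond_exp_wnorm_sq[OF assms(5) R a assms(9,10,12,14)]
    by eventually_elim
       (simp add: wnorm_sq_minus sum_wnorm_sq_columns_residual GDF_def ring_distribs)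
  moreover have "AE \<omega> in M. MSPE0 M A \<Phi> D \<mu> y K x \<omega> =
      real_cond_exp M A (R_loss \<Phi> D y K x) \<omega> + 2 * \<sigma>2 * GDF \<Phi> D K x \<omega> - \<sigma>2"
    if "AE \<omega> in M. trace (?D \<omega>) = 1"
    using main that by eventually_elim simp
  ultimately show ?thesis
    by blast
qed

end
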